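(* Every (Hausdorff) topological group whose underlying space is Čech-complete is a $\kappa$-Fréchet--Urysohn space. Consequently, every locally compact (Hausdorff) topological group is a $\kappa$-Fréchet--Urysohn space.
   Context: All topological spaces are assumed to be Tychonoff. A space $X$ is called $\kappa$-Fréchet--Urysohn if for every open subset $U$ of $X$ and every $x\in\overline{U}$ there exists a sequence $\{x_n\}_{n\in\omega}\subseteq U$ converging to $x$. A Čech-complete space is a Tychonoff space $X$ that is a $G_\delta$-subset of its Stone--Čech compactification $\beta X$. *)

theory Defs
  imports "HOL-Analysis.Analysis"
begin

definition tychonoff_space :: "'a topology \<Rightarrow> bool" where
  "tychonoff_space X \<longleftrightarrow> completely_regular_space X \<and> Hausdorff_space X"

text \<open>
  The Stone--\v{C}ech compactification of \<open>X\<close> is constructed as the closure of the image of \<open>X\<close>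
  under the evaluation map into the cube $[0,1]^{C(X,[0,1])}$. Members of \<open>C(X,[0,1])\<close> are
  normalised outside \<open>topspace X\<close> so that each continuous map occurs exactly once as an index.
\<close>

definition unit_maps :: "'a topology \<Rightarrow> ('a \<Rightarrow> real) set" where
  "unit_maps X = {f \<in> extensional (topspace X). continuous_map X (top_of_set {0..1}) f}"

definition unit_cube :: "'a topology \<Rightarrow> (('a \<Rightarrow> real) \<Rightarrow> real) topology" where
  "unit_cube X = product_topology (\<lambda>_. top_of_set {0..1}) (unit_maps X)"

definition stone_cech_map :: "'a topology \<Rightarrow> 'a \<Rightarrow> ('a \<Rightarrow> real) \<Rightarrow> real" where
  "stone_cech_map X x = (\<lambda>f\<in>unit_maps X. f x)"

definition stone_cech :: "'a topology \<Rightarrow> (('a \<Rightarrow> real) \<Rightarrow> real) topology" where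
  "stone_cech X = subtopology (unit_cube X) (unit_cube X closure_of (stone_cech_map X ` topspace X))"

definition cech_complete_space :: "'a topology \<Rightarrow> bool" where
  "cech_complete_space X \<longleftrightarrow>
     tychonoff_space X \<and> gdelta_in (stone_cech X) (stone_cech_map X ` topspace X)"

definition kappa_frechet_urysohn_space :: "'a topology \<Rightarrow> bool" where
  "kappa_frechet_urysohn_space X \<longleftrightarrow>
     (\<forall>U x. openin X U \<and> x \<in> X closure_of U \<longrightarrow>
        (\<exists>\<sigma>::nat \<Rightarrow> 'a. range \<sigma> \<subseteq> U \<and> limitin X \<sigma> x sequentially))"

text \<open>
  The next facts confirm that \<open>stone_cech X\<close>, together with \<open>stone_cech_map X\<close>, is a Hausdorff
  compactification of a Tychonoff space \<open>X\<close> to which every continuous map into the unit interval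
  extends; this determines it up to homeomorphism over \<open>X\<close>.
\<close>

lemma compact_space_stone_cech: "compact_space (stone_cech X)"
proof -
  have "compact_space (unit_cube X)"
    unfolding unit_cube_def by (simp add: compact_space_product_topology compact_space_subtopology)
  then show ?thesis
    unfolding stone_cech_def
    by (simp add: closedin_compact_space compact_space_subtopology)
qed

lemma Hausdorff_space_stone_cech: "Hausdorff_space (stone_cech X)"
  unfolding stone_cech_def unit_cube_def
  by (intro Hausdorff_space_subtopology)
     (simp add: Hausdorff_space_product_topology Hausdorff_space_subtopology)

lemma continuous_map_stone_cech_map_cube: "continuous_map X (unit_cube X) (stone_cech_map X)"
  unfolding unit_cube_def continuous_map_componentwise
  by (auto simp: stone_cech_map_def unit_maps_def)

lemma stone_cech_map_image_subset:
  "stone_cech_map X ` topspace X \<subseteq> topspace (stone_cech X)"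
  using continuous_map_image_subset_topspace[OF continuous_map_stone_cech_map_cube[of X]]
  by (simp add: stone_cech_def closure_of_subset)

lemma continuous_map_stone_cech_map: "continuous_map X (stone_cech X) (stone_cech_map X)"
  using continuous_map_stone_cech_map_cube stone_cech_map_image_subset[of X]
  by (auto simp: stone_cech_def continuous_map_in_subtopology)

lemma dense_stone_cech_map:
  "stone_cech X closure_of (stone_cech_map X ` topspace X) = topspace (stone_cech X)"
proof -
  have "stone_cech_map X ` topspace X \<subseteq> unit_cube X closure_of (stone_cech_map X ` topspace X)"
    using stone_cech_map_image_subset[of X] by (auto simp: stone_cech_def)
  then show ?thesis
    by (auto simp: stone_cech_def closure_of_subtopology Int_absorb1 closure_of_subset_topspace
             dest: subsetD[OF closure_of_subset_topspace])
qed

lemma embedding_map_stone_cech_map: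
  assumes "tychonoff_space X"
  shows "embedding_map X (stone_cech X) (stone_cech_map X)"
proof -
  let ?e = "stone_cech_map X" and ?B = "stone_cech X"
  let ?E = "subtopology ?B (?e ` topspace X)"
  have sep: "\<exists>f\<in>unit_maps X. f x = 0 \<and> f ` (topspace X - U) \<subseteq> {1}"
    if "openin X U" "x \<in> U" for U x
  proof -
    have "closedin X (topspace X - U)" "x \<in> topspace X - (topspace X - U)"
      using that openin_subset[OF that(1)] by auto
    then obtain f where f: "continuous_map X (top_of_set {0..1}) f" "f x = (0::real)"
        "f ` (topspace X - U) \<subseteq> {1}"
      using assms unfolding tychonoff_space_def completely_regular_space_def by metis
    have "restrict f (topspace X) \<in> unit_maps X"
      using f(1) by (auto simp: unit_maps_def intro: continuous_map_eq)
    then show ?thesis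
      using f(2,3) that openin_subset[OF that(1)]
      by (intro bexI[of _ "restrict f (topspace X)"]) auto
  qed
  have inj: "inj_on ?e (topspace X)"
  proof (rule inj_onI, rule ccontr)
    fix x y assume xy: "x \<in> topspace X" "y \<in> topspace X" "?e x = ?e y" "x \<noteq> y"
    then obtain U where U: "openin X U" "x \<in> U" "y \<notin> U"
      using assms unfolding tychonoff_space_def Hausdorff_space_def disjnt_iff by metis
    from sep[OF U(1,2)] obtain f where "f \<in> unit_maps X" "f x = 0" "f y = 1"
      using xy(2) U(3) by auto
    then show False
      using fun_cong[OF xy(3), of f] by (simp add: stone_cech_map_def)
  qed
  have "openin ?E (?e ` U)" if U: "openin X U" for U
  proof (subst openin_subopen, safe)
    fix x assume x: "x \<in> U"
    obtain f where f: "f \<in> unit_maps X" "f x = 0" "f ` (topspace X - U) \<subseteq> {1}"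
      using sep[OF U x] by blast
    define T where "T = {z \<in> topspace (unit_cube X). z f \<in> {..<1}}"
    have "continuous_map (unit_cube X) euclideanreal (\<lambda>z. z f)"
      using continuous_map_product_projection[OF f(1), of "\<lambda>_. top_of_set {0..1::real}"]
      unfolding unit_cube_def by (simp add: continuous_map_in_subtopology)
    then have T: "openin (unit_cube X) T"
      unfolding T_def by (rule openin_continuous_map_preimage) simp
    have "openin ?E (T \<inter> ?e ` topspace X)"
      using T stone_cech_map_image_subset[of X]
      by (auto simp: stone_cech_def subtopology_subtopology openin_subtopology Int_absorb1)
    moreover have "?e x \<in> T \<inter> ?e ` topspace X"
    proof -
      have "x \<in> topspace X" using x openin_subset[OF U] by blast
      moreover from this have "?e x \<in> topspace (unit_cube X)"
        using stone_cech_map_image_subset[of X] by (simp add: stone_cech_def image_subset_iff)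
      moreover have "?e x f < 1"
        using f(1,2) by (simp add: stone_cech_map_def)
      ultimately show ?thesis
        by (simp add: T_def)
    qed
    moreover have "T \<inter> ?e ` topspace X \<subseteq> ?e ` U"
      using f(1,3) by (force simp: T_def stone_cech_map_def)
    ultimately show "\<exists>T. openin ?E T \<and> ?e x \<in> T \<and> T \<subseteq> ?e ` U" by blast
  qed
  then have "open_map X ?E ?e" by (simp add: open_map_def)
  moreover have "continuous_map X ?E ?e"
    by (simp add: continuous_map_in_subtopology continuous_map_stone_cech_map)
  moreover have "?e ` topspace X = topspace ?E"
    using stone_cech_map_image_subset[of X] by auto
  ultimately show ?thesis
    using inj unfolding embedding_map_def by (simp only: bijective_open_imp_homeomorphic_map)
qed

lemma stone_cech_extension:
  assumes "continuous_map X (top_of_set {0..1::real}) f"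
  obtains g where "continuous_map (stone_cech X) (top_of_set {0..1}) g"
    "\<And>x. x \<in> topspace X \<Longrightarrow> g (stone_cech_map X x) = f x"
proof
  let ?f = "restrict f (topspace X)"
  have f: "?f \<in> unit_maps X"
    using assms by (auto simp: unit_maps_def intro: continuous_map_eq)
  show "continuous_map (stone_cech X) (top_of_set {0..1}) (\<lambda>z. z ?f)"
    unfolding stone_cech_def unit_cube_def
    by (intro continuous_map_from_subtopology continuous_map_product_projection f)
  show "stone_cech_map X x ?f = f x" if "x \<in> topspace X" for x
    using f that by (simp add: stone_cech_map_def)
qed

end

theory Submission
  imports Defs
begin

text \<open>
  By translation it suffices to reach \<open>0\<close> from an open \<open>U\<close> with \<open>0\<close> in its closure. Choose alternately
  symmetric open neighbourhoods \<open>V n\<close> of \<open>0\<close> and points \<open>x n\<close> of \<open>V n \<inter> U\<close> such that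
  \<open>V (n+1) + V (n+1) \<subseteq> V n\<close> and \<open>x n + V (n+1) \<subseteq> U\<close>. If the \<open>V n\<close> are small enough, completeness makes
  \<open>N = \<Inter>n. V n\<close> a compact subgroup with neighbourhood base \<open>V n\<close>; so the cosets \<open>x n + N \<subseteq> U\<close>
  converge to \<open>N\<close>. It remains to pick \<open>y n \<in> x n + N\<close> converging to \<open>0\<close>. By Zorn's lemma there is a
  minimal sequence of cosets \<open>C n \<subseteq> x n + N\<close> of a compact subgroup \<open>M \<subseteq> N\<close> that converges to \<open>M\<close>. If
  \<open>M\<close> were nontrivial, intersecting it with the intersection of another sequence of neighbourhoods
  would give a smaller one, as a diagonal choice lifts the convergence. So \<open>M = {0}\<close>.
\<close>

section \<open>Compactness and cluster points\<close>

text \<open>If every \<open>A\<close> left \<open>W\<close>, the closed sets \<open>A - W\<close>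
  would have the finite intersection property, since a finite subfamily of a chain has a least
  member; compactness then gives a point of \<open>\<Inter>\<F>\<close> outside
  \<open>W\<close>.\<close>

lemma compact_chain_subset_open:
  fixes \<F> :: "'a::t2_space set set"
  assumes "\<F> \<noteq> {}" and chain: "subset.chain UNIV \<F>"
    and comp: "\<And>A. A \<in> \<F> \<Longrightarrow> compact A"
    and W: "open W" "\<Inter>\<F> \<subseteq> W"
  obtains A where "A \<in> \<F>" "A \<subseteq> W"
proof (rule ccontr)
  assume "\<not> thesis"
  with that have no: "\<not> A \<subseteq> W" if "A \<in> \<F>" for A
    using that by blast
  obtain A\<^sub>0 where A\<^sub>0: "A\<^sub>0 \<in> \<F>"
    using \<open>\<F> \<noteq> {}\<close> by blast
  have "A\<^sub>0 \<inter> (\<Inter>A\<in>\<F>. A - W) \<noteq> {}"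
  proof (rule compact_imp_fip_image)
    show "compact A\<^sub>0"
      by (rule comp[OF A\<^sub>0])
    show "closed (A - W)" if "A \<in> \<F>" for A
      using comp[OF that] W(1) by (intro closed_Diff compact_imp_closed)
    fix \<G> assume \<G>: "finite \<G>" "\<G> \<subseteq> \<F>"
    have "\<Inter>(insert A\<^sub>0 \<G>) \<in> insert A\<^sub>0 \<G>"
      using \<G> A\<^sub>0 chain by (intro Inter_in_chain[where \<A> = UNIV]) (auto simp: subset_chain_def)
    then have "\<not> \<Inter>(insert A\<^sub>0 \<G>) \<subseteq> W"
      using no \<G> A\<^sub>0 by (metis insert_subset subsetD)
    then show "A\<^sub>0 \<inter> (\<Inter>A\<in>\<G>. A - W) \<noteq> {}"
      by auto
  qed
  then show False
    using W(2) A\<^sub>0 by blast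
qed

text \<open>Here \<open>inf (nhds p) F \<noteq> bot\<close> expresses that \<open>p\<close> is a
  cluster point of \<open>F\<close>.\<close>

lemma cluster_point_in_closed:
  assumes "inf (nhds p) F \<noteq> bot" "closed A" "eventually (\<lambda>x. x \<in> A) F"
  shows "p \<in> A"
proof (rule ccontr)
  assume "p \<notin> A"
  with \<open>closed A\<close> have "eventually (\<lambda>x. x \<in> - A) (nhds p)"
    by (intro eventually_nhds_in_open) auto
  with assms(3) have "eventually (\<lambda>x. False) (inf (nhds p) F)"
    unfolding eventually_inf by (intro exI[of _ "\<lambda>x. x \<in> - A"] exI[of _ "\<lambda>x. x \<in> A"]) simp
  with assms(1) show False
    by (simp add: trivial_limit_def)
qed

section \<open>Subgroups and their cosets\<close>

text \<open>The additive notation does not imply commutativity, so the translates by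
  \<open>(+) y\<close> below are left cosets.\<close>

definition add_subgroup :: "'a::group_add set \<Rightarrow> bool" where
  "add_subgroup M \<longleftrightarrow> 0 \<in> M \<and> (\<forall>x\<in>M. \<forall>y\<in>M. x - y \<in> M)"

lemma add_subgroupD:
  assumes "add_subgroup M"
  shows "0 \<in> M" "x \<in> M \<Longrightarrow> - x \<in> M" "x \<in> M \<Longrightarrow> y \<in> M \<Longrightarrow> x + y \<in> M"
proof -
  show "0 \<in> M" using assms by (simp add: add_subgroup_def)
  have *: "- x \<in> M" if "x \<in> M" for x
    using assms that unfolding add_subgroup_def by (metis diff_0)
  show "x \<in> M \<Longrightarrow> - x \<in> M" by (rule *)
  show "x \<in> M \<Longrightarrow> y \<in> M \<Longrightarrow> x + y \<in> M"
    using assms *[of y] unfolding add_subgroup_def by (metis diff_minus_eq_add)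
qed

lemma mem_coset_iff: "z \<in> (+) y ` M \<longleftrightarrow> - y + z \<in> M" for z :: "'a::group_add"
proof
  assume "- y + z \<in> M"
  then have "y + (- y + z) \<in> (+) y ` M" by (rule imageI)
  then show "z \<in> (+) y ` M" by simp
qed auto

lemma coset_eqI:
  assumes "add_subgroup M" "z \<in> (+) y ` M"
  shows "(+) y ` M = (+) z ` M"
proof -
  have yz: "- y + z \<in> M" using assms(2) by (simp add: mem_coset_iff)
  then have zy: "- z + y \<in> M"
    using add_subgroupD(2)[OF assms(1) yz] by (simp add: minus_add)
  have "- y + w \<in> M \<longleftrightarrow> - z + w \<in> M" for w
    using add_subgroupD(3)[OF assms(1) zy, of "- y + w"] add_subgroupD(3)[OF assms(1) yz, of "- z + w"]
    by (auto simp: add.assoc)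
  then show ?thesis
    by (intro set_eqI) (simp add: mem_coset_iff)
qed

lemma coset_Int:
  fixes y :: "'a::group_add"
  shows "(\<Inter>i\<in>I. (+) y ` M i) = (+) y ` (\<Inter>i\<in>I. M i)"
  by (rule set_eqI) (simp only: mem_coset_iff INT_iff)

section \<open>Chains of neighbourhoods of zero\<close>

lemma open_translate_vimage:
  fixes V :: "'a::topological_group_add set"
  assumes "open V"
  shows "open {y. a + y \<in> V}" "open {y. y - a \<in> V}" "open {y. - y \<in> V}"
proof -
  have "open ((\<lambda>y. a + y) -` V)" "open ((\<lambda>y. y - a) -` V)" "open ((\<lambda>y. - y) -` V)"
    using assms by (intro open_vimage continuous_intros; assumption)+
  then show "open {y. a + y \<in> V}" "open {y. y - a \<in> V}" "open {y. - y \<in> V}"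
    by (simp_all add: vimage_def)
qed

lemma symmetric_open_nhd:
  fixes V :: "'a::topological_group_add set"
  assumes "open V" "0 \<in> V"
  obtains W where "open W" "0 \<in> W" "\<And>x. x \<in> W \<Longrightarrow> - x \<in> W"
    "\<And>x y. x \<in> W \<Longrightarrow> y \<in> W \<Longrightarrow> x + y \<in> V"
proof -
  have "filterlim (\<lambda>z. fst z + snd z) (nhds (0 + 0)) (nhds (0::'a) \<times>\<^sub>F nhds 0)"
    by (rule tendsto_add_Pair)
  then have "eventually (\<lambda>z. fst z + snd z \<in> V) (nhds (0::'a) \<times>\<^sub>F nhds 0)"
    using assms by (simp add: tendsto_def)
  then obtain P where "eventually P (nhds (0::'a))" "\<And>x y. P x \<Longrightarrow> P y \<Longrightarrow> x + y \<in> V"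
    unfolding eventually_prod_same by auto
  then obtain T where T: "open T" "0 \<in> T" "\<And>x y. x \<in> T \<Longrightarrow> y \<in> T \<Longrightarrow> x + y \<in> V"
    unfolding eventually_nhds by blast
  show thesis
    \<comment> \<open>Intersecting \<open>T\<close> with its reflection makes it symmetric.\<close>
    using T by (intro that[of "T \<inter> {y. - y \<in> T}"]) (auto simp: open_translate_vimage)
qed

text \<open>Halving chains as in the Birkhoff-Kakutani theorem. They need not form a base at
  \<open>0\<close>: the intersection may be a nontrivial subgroup.\<close>

definition nhd_chain :: "(nat \<Rightarrow> 'a::topological_group_add set) \<Rightarrow> bool" where
  "nhd_chain V \<longleftrightarrow> (\<forall>n. open (V n) \<and> 0 \<in> V n \<and> (\<forall>x\<in>V n. - x \<in> V n) \<and>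
     (\<forall>x\<in>V (Suc n). \<forall>y\<in>V (Suc n). x + y \<in> V n))"

lemma nhd_chain_exists:
  fixes U :: "'a::topological_group_add set"
  assumes "open U" "0 \<in> U"
  obtains V where "nhd_chain V" "V 0 \<subseteq> U"
proof -
  define P where "P = (\<lambda>(n::nat) (V::'a set). open V \<and> 0 \<in> V \<and> (\<forall>x\<in>V. - x \<in> V) \<and> V \<subseteq> U)"
  have "\<exists>V. \<forall>n. P n (V n) \<and> (\<forall>x\<in>V (Suc n). \<forall>y\<in>V (Suc n). x + y \<in> V n)"
  proof (rule dependent_nat_choice)
    obtain W where "open W" "0 \<in> W" "\<And>x. x \<in> W \<Longrightarrow> - x \<in> W"
      "\<And>x y. x \<in> W \<Longrightarrow> y \<in> W \<Longrightarrow> x + y \<in> U"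
      using symmetric_open_nhd[OF assms] by blast
    then show "\<exists>V. P 0 V"
      unfolding P_def by (intro exI[of _ W]) (metis add_0 subsetI)
    fix V and n :: nat assume V: "P n V"
    obtain W where "open W" "0 \<in> W" "\<And>x. x \<in> W \<Longrightarrow> - x \<in> W"
      "\<And>x y. x \<in> W \<Longrightarrow> y \<in> W \<Longrightarrow> x + y \<in> V"
      using symmetric_open_nhd[of V] V unfolding P_def by blast
    then show "\<exists>W. P (Suc n) W \<and> (\<forall>x\<in>W. \<forall>y\<in>W. x + y \<in> V)"
      using V unfolding P_def by (intro exI[of _ W]) (metis add_0 subset_iff)
  qed
  then show thesis
    using that unfolding nhd_chain_def P_def by metis
qed

context
  fixes V :: "nat \<Rightarrow> 'a::topological_group_add set"
  assumes V: "nhd_chain V"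
begin

lemma nhd_chain_open: "open (V n)"
  and nhd_chain_zero: "0 \<in> V n"
  and nhd_chain_minus: "x \<in> V n \<Longrightarrow> - x \<in> V n"
  and nhd_chain_add: "x \<in> V (Suc n) \<Longrightarrow> y \<in> V (Suc n) \<Longrightarrow> x + y \<in> V n"
  using V unfolding nhd_chain_def by blast+

lemma nhd_chain_mono:
  assumes "m \<le> n" shows "V n \<subseteq> V m"
proof -
  have "V (Suc n) \<subseteq> V n" for n
    using nhd_chain_add[of _ n 0] nhd_chain_zero by auto
  then show ?thesis
    using assms by (rule lift_Suc_antimono_le)
qed

text \<open>For \<open>p\<close> in the closure, its neighbourhood \<open>p + V (Suc n)\<close>
  contains some \<open>q\<close> of \<open>V (Suc n)\<close>, and \<open>p = q - (- p + q)\<close>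
  is a sum of two elements of the symmetric set \<open>V (Suc n)\<close>.\<close>

lemma nhd_chain_closure: "closure (V (Suc n)) \<subseteq> V n"
proof
  fix p assume p: "p \<in> closure (V (Suc n))"
  have "open {y. - p + y \<in> V (Suc n)}" "p \<in> {y. - p + y \<in> V (Suc n)}"
    by (simp_all add: open_translate_vimage nhd_chain_open nhd_chain_zero)
  then obtain q where q: "- p + q \<in> V (Suc n)" "q \<in> V (Suc n)"
    using p open_Int_closure_eq_empty[of "{y. - p + y \<in> V (Suc n)}" "V (Suc n)"] by blast
  have "p = q + - (- p + q)"
    by (simp add: minus_add)
  then show "p \<in> V n"
    using q nhd_chain_add nhd_chain_minus by metis
qed

lemma nhd_chain_Inter_closure: "(\<Inter>n. closure (V n)) = (\<Inter>n. V n)"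
proof
  show "(\<Inter>n. closure (V n)) \<subseteq> (\<Inter>n. V n)"
    using nhd_chain_closure by blast
  show "(\<Inter>n. V n) \<subseteq> (\<Inter>n. closure (V n))"
    using closure_subset by (rule INF_mono')
qed

lemma closed_nhd_chain_Inter: "closed (\<Inter>n. V n)"
  unfolding nhd_chain_Inter_closure[symmetric] by (intro closed_INT ballI closed_closure)

lemma add_subgroup_nhd_chain_Inter: "add_subgroup (\<Inter>n. V n)"
  unfolding add_subgroup_def
proof (intro conjI ballI INT_I)
  show "0 \<in> V n" for n by (rule nhd_chain_zero)
  fix x y n assume "x \<in> (\<Inter>n. V n)" "y \<in> (\<Inter>n. V n)"
  then have "x + - y \<in> V n"
    by (intro nhd_chain_add nhd_chain_minus) auto
  then show "x - y \<in> V n" by simp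
qed

end

section \<open>Sequences of cosets converging to a compact subgroup\<close>

text \<open>Convergence in the upper Vietoris sense. For \<open>M = {0}\<close> each
  \<open>C n\<close> is a single point and the last condition is ordinary convergence to
  \<open>0\<close>.\<close>

definition cosets_tendsto :: "'a::topological_group_add set \<Rightarrow> (nat \<Rightarrow> 'a set) \<Rightarrow> bool" where
  "cosets_tendsto M C \<longleftrightarrow> compact M \<and> add_subgroup M \<and> (\<forall>n. \<exists>y. C n = (+) y ` M) \<and>
     (\<forall>W. open W \<and> M \<subseteq> W \<longrightarrow> (\<forall>\<^sub>F n in sequentially. C n \<subseteq> W))"

text \<open>Translating the term \<open>C 0\<close> back by one of its points recovers
  \<open>M\<close>. Hence \<open>C\<close> determines \<open>M\<close>, and Zorn's lemma can be
  applied to the sequences alone.\<close>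

lemma cosets_tendsto_mono:
  assumes "cosets_tendsto M C" "cosets_tendsto M' C'" "C \<le> C'"
  shows "M \<subseteq> M'"
proof
  fix m assume m: "m \<in> M"
  obtain y y' where y: "C 0 = (+) y ` M" "C' 0 = (+) y' ` M'"
    using assms(1,2) unfolding cosets_tendsto_def by metis
  have M: "add_subgroup M" "add_subgroup M'"
    using assms by (auto simp: cosets_tendsto_def)
  have "y + 0 \<in> C 0" "y + m \<in> C 0"
    using y(1) m add_subgroupD(1)[OF M(1)] by blast+
  then have *: "y \<in> (+) y' ` M'" "y + m \<in> (+) y' ` M'"
    using assms(3) y(2) by (auto simp: le_fun_def)
  show "m \<in> M'"
    using *(2) unfolding coset_eqI[OF M(2) *(1)] by (simp add: mem_coset_iff)
qed

text \<open>This provides the lower bounds for Zorn's lemma. Compactness keeps the intersections of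
  cosets nonempty and puts a single \<open>M C\<close> inside any given neighbourhood of the
  intersected subgroups.\<close>

lemma cosets_tendsto_chain_Inter:
  fixes K :: "(nat \<Rightarrow> 'a::{topological_group_add, t2_space} set) set"
  assumes "K \<noteq> {}" and chain: "\<And>C D. C \<in> K \<Longrightarrow> D \<in> K \<Longrightarrow> C \<le> D \<or> D \<le> C"
    and M: "\<And>C. C \<in> K \<Longrightarrow> cosets_tendsto (M C) C"
  shows "cosets_tendsto (\<Inter>C\<in>K. M C) (\<lambda>n. \<Inter>C\<in>K. C n)"
  unfolding cosets_tendsto_def
proof (intro conjI allI impI)
  have compM: "compact (M C)" and subM: "add_subgroup (M C)"
    and cos: "\<exists>y. C n = (+) y ` M C" if "C \<in> K" for C n
    using M[OF that] by (auto simp: cosets_tendsto_def)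
  have chM: "subset.chain UNIV (M ` K)"
    unfolding subset_chain_def using chain cosets_tendsto_mono[OF M M] by blast
  have chn: "subset.chain UNIV ((\<lambda>C. C n) ` K)" for n
    unfolding subset_chain_def using chain le_funD[where x = n] by blast
  show "compact (\<Inter>C\<in>K. M C)"
  proof -
    obtain C where "C \<in> K" using \<open>K \<noteq> {}\<close> by blast
    moreover have "closed (\<Inter>C\<in>K. M C)"
      by (intro closed_INT ballI compact_imp_closed compM)
    ultimately have "compact (M C \<inter> (\<Inter>C\<in>K. M C))"
      by (intro compact_Int_closed compM)
    moreover have "M C \<inter> (\<Inter>C\<in>K. M C) = (\<Inter>C\<in>K. M C)"
      using \<open>C \<in> K\<close> by blast
    ultimately show ?thesis by simp
  qed
  show "add_subgroup (\<Inter>C\<in>K. M C)"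
    using subM unfolding add_subgroup_def by blast
  show "\<exists>y. (\<Inter>C\<in>K. C n) = (+) y ` (\<Inter>C\<in>K. M C)" for n
  proof -
    have "(\<Inter>C\<in>K. C n) \<noteq> {}"
    proof
      assume "(\<Inter>C\<in>K. C n) = {}"
      \<comment> \<open>An empty intersection lies in the open set \<open>{}\<close>, so by
        compactness some \<open>C n\<close> would itself be empty.\<close>
      then have sub: "\<Inter>((\<lambda>C. C n) ` K) \<subseteq> {}" by simp
      have "compact (C n)" if "C \<in> K" for C
        using cos[OF that, of n] compM[OF that]
        by (auto intro!: compact_continuous_image continuous_intros)
      then obtain A where "A \<in> (\<lambda>C. C n) ` K" "A \<subseteq> {}"
        using compact_chain_subset_open[OF _ chn _ open_empty sub] \<open>K \<noteq> {}\<close> by blast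
      then obtain C where "C \<in> K" "C n = {}" by auto
      then show False
        using cos[of C n] add_subgroupD(1)[OF subM] by auto
    qed
    then obtain z where z: "\<And>C. C \<in> K \<Longrightarrow> z \<in> C n" by blast
    \<comment> \<open>The common point \<open>z\<close> represents all these cosets
      simultaneously.\<close>
    have "C n = (+) z ` M C" if "C \<in> K" for C
      using cos[OF that, of n] z[OF that] coset_eqI[OF subM[OF that]] by metis
    then have "(\<Inter>C\<in>K. C n) = (\<Inter>C\<in>K. (+) z ` M C)" by simp
    then show ?thesis using coset_Int by metis
  qed
  fix W assume W: "open W \<and> (\<Inter>C\<in>K. M C) \<subseteq> W"
  then obtain A where "A \<in> M ` K" "A \<subseteq> W"
    using compact_chain_subset_open[OF _ chM, of W] compM \<open>K \<noteq> {}\<close> by blast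
  then obtain C where C: "C \<in> K" "M C \<subseteq> W" by blast
  then have "\<forall>\<^sub>F n in sequentially. C n \<subseteq> W"
    using M[OF C(1)] W by (auto simp: cosets_tendsto_def)
  then show "\<forall>\<^sub>F n in sequentially. (\<Inter>C\<in>K. C n) \<subseteq> W"
    by (rule eventually_mono) (use C(1) in blast)
qed

lemma diagonal_selection:
  fixes C V :: "nat \<Rightarrow> 'a set"
  assumes "\<And>n. C n \<noteq> {}" "antimono V" "\<And>k. \<forall>\<^sub>F n in sequentially. C n \<inter> V k \<noteq> {}"
  obtains y where "\<And>n. y n \<in> C n" "\<And>k. \<forall>\<^sub>F n in sequentially. y n \<in> V k"
proof -
  \<comment> \<open>\<open>J n\<close> collects the levels that \<open>C n\<close> meets; the bound
    \<open>k \<le> n\<close> makes it finite, so \<open>y n\<close> can be taken in the deepest one.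
    If \<open>J n\<close> is empty, any point of \<open>C n\<close> will do.\<close>
  define J where "J n = {k. k \<le> n \<and> C n \<inter> V k \<noteq> {}}" for n
  have fin: "finite (J n)" for n
    unfolding J_def by (rule finite_subset[of _ "{..n}"]) auto
  have "\<exists>z. z \<in> C n \<and> (J n \<noteq> {} \<longrightarrow> z \<in> V (Max (J n)))" for n
  proof (cases "J n = {}")
    case False
    then show ?thesis using Max_in[OF fin False] by (auto simp: J_def)
  qed (use assms(1)[of n] in auto)
  then obtain y where y: "\<And>n. y n \<in> C n" "\<And>n. J n \<noteq> {} \<Longrightarrow> y n \<in> V (Max (J n))"
    by metis
  show thesis
  proof (rule that[OF y(1)])
    fix k
    show "\<forall>\<^sub>F n in sequentially. y n \<in> V k"
      using assms(3)[of k] eventually_ge_at_top[of k]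
    proof eventually_elim
      case (elim n)
      then have k: "k \<in> J n" by (simp add: J_def)
      then have "k \<le> Max (J n)" using fin by simp
      then have "V (Max (J n)) \<subseteq> V k" by (rule antimonoD[OF assms(2)])
      then show ?case using y(2)[of n] k by blast
    qed
  qed
qed

text \<open>\<open>M\<close> is cut down by a closed subgroup missing \<open>m\<close>; the new
  cosets pass through points \<open>y n\<close> of \<open>C n\<close> that eventually enter every
  \<open>V k\<close>.\<close>

lemma cosets_tendsto_refine:
  fixes M :: "'a::{topological_group_add, t2_space} set"
  assumes C: "cosets_tendsto M C" and m: "m \<in> M" "m \<noteq> 0"
  obtains M' C' where "cosets_tendsto M' C'" "C' \<le> C" "m \<notin> M'"
proof -
  have compM: "compact M" and subM: "add_subgroup M" and cos: "\<And>n. \<exists>y. C n = (+) y ` M"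
    and lim: "\<And>W. open W \<Longrightarrow> M \<subseteq> W \<Longrightarrow> \<forall>\<^sub>F n in sequentially. C n \<subseteq> W"
    using C by (auto simp: cosets_tendsto_def)
  obtain U where "open U" "0 \<in> U" "m \<notin> U"
    using t1_space[of 0 m] m(2) by metis
  then obtain V where V: "nhd_chain V" "m \<notin> V 0"
    using nhd_chain_exists by (metis subsetD)
  define M' where "M' = M \<inter> (\<Inter>n. V n)"
  have subM': "add_subgroup M'"
    using subM add_subgroup_nhd_chain_Inter[OF V(1)] by (auto simp: M'_def add_subgroup_def)
  have meets: "\<forall>\<^sub>F n in sequentially. C n \<inter> V k \<noteq> {}" for k
  proof -
    \<comment> \<open>\<open>W\<close> is \<open>V k + M\<close>. Once
      \<open>C n \<subseteq> W\<close>, a representative of \<open>C n\<close> is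
      \<open>v + a\<close> with \<open>v\<close> in \<open>V k\<close> and \<open>a\<close> in
      \<open>M\<close>, and \<open>v\<close> still belongs to \<open>C n\<close>.\<close>
    define W where "W = (\<Union>a\<in>M. {y. y - a \<in> V k})"
    have "open W"
      unfolding W_def by (intro open_UN ballI open_translate_vimage nhd_chain_open V)
    moreover have "M \<subseteq> W"
      using nhd_chain_zero[OF V(1)] by (auto simp: W_def)
    ultimately have "\<forall>\<^sub>F n in sequentially. C n \<subseteq> W" by (rule lim)
    then show ?thesis
    proof eventually_elim
      case (elim n)
      obtain y where y: "C n = (+) y ` M" using cos by blast
      then have "y \<in> C n" using add_subgroupD(1)[OF subM] by force
      then obtain a where a: "a \<in> M" "y - a \<in> V k" using elim by (auto simp: W_def)
      have "y + - a \<in> C n" using y add_subgroupD(2)[OF subM a(1)] by blast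
      then show ?case using a(2) by auto
    qed
  qed
  have "C n \<noteq> {}" for n
    using cos[of n] add_subgroupD(1)[OF subM] by auto
  moreover have "antimono V"
    using nhd_chain_mono[OF V(1)] by (auto intro!: antimonoI)
  ultimately obtain y where y: "\<And>n. y n \<in> C n" "\<And>k. \<forall>\<^sub>F n in sequentially. y n \<in> V k"
    using meets by (metis diagonal_selection)
  define C' where "C' n = (+) (y n) ` M'" for n
  have C_eq: "C n = (+) (y n) ` M" for n
    using cos[of n] y(1)[of n] coset_eqI[OF subM] by metis
  have "C' \<le> C"
    unfolding le_fun_def C_eq C'_def M'_def by blast
  moreover have "m \<notin> M'"
    using V(2) by (auto simp: M'_def)
  moreover have "cosets_tendsto M' C'"
    unfolding cosets_tendsto_def
  proof (intro conjI allI impI)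
    show "compact M'"
      unfolding M'_def using compM closed_nhd_chain_Inter[OF V(1)] by (rule compact_Int_closed)
    show "add_subgroup M'" by (rule subM')
    show "\<exists>y. C' n = (+) y ` M'" for n by (auto simp: C'_def)
    fix W assume W: "open W \<and> M' \<subseteq> W"
    \<comment> \<open>The compact sets \<open>M \<inter> closure (V k)\<close> decrease to
      \<open>M'\<close>.\<close>
    have "\<exists>k. M \<inter> closure (V k) \<subseteq> W"
    proof -
      let ?F = "range (\<lambda>k. M \<inter> closure (V k))"
      have "subset.chain UNIV ?F"
        unfolding subset_chain_def
        using closure_mono[OF nhd_chain_mono[OF V(1)]] by (auto, meson linear subset_iff)
      moreover have "\<Inter>?F \<subseteq> W"
        using W nhd_chain_Inter_closure[OF V(1)] by (auto simp: M'_def)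
      ultimately obtain A where "A \<in> ?F" "A \<subseteq> W"
        using compact_chain_subset_open[of ?F W] W compM by blast
      then show ?thesis by blast
    qed
    then obtain k where k: "M \<inter> closure (V k) \<subseteq> W" ..
    \<comment> \<open>This union is a neighbourhood of all of \<open>M\<close>, so the convergence
      of \<open>C\<close> applies; as \<open>C' n\<close> also lies in \<open>V k\<close>, it ends
      up in \<open>W\<close>. The index \<open>Suc k\<close> leaves room for adding an element of
      \<open>M'\<close> to \<open>y n\<close>.\<close>
    have "\<forall>\<^sub>F n in sequentially. C n \<subseteq> W \<union> - closure (V k)"
      using k W by (intro lim open_Un) auto
    with y(2)[of "Suc k"] show "\<forall>\<^sub>F n in sequentially. C' n \<subseteq> W"
    proof eventually_elim
      case (elim n)
      have "C' n \<subseteq> V k"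
        using nhd_chain_add[OF V(1) elim(1)] by (auto simp: C'_def M'_def)
      moreover have "V k \<subseteq> closure (V k)" by (rule closure_subset)
      ultimately show ?case
        using \<open>C' \<le> C\<close> elim(2) unfolding le_fun_def by blast
    qed
  qed
  ultimately show thesis using that by blast
qed

lemma cosets_tendsto_selection:
  fixes N :: "'a::{topological_group_add, t2_space} set"
  assumes D: "cosets_tendsto N D"
  obtains y where "\<And>n. y n \<in> D n" "y \<longlonglongrightarrow> 0"
proof -
  define A where "A = {C. C \<le> D \<and> (\<exists>M. cosets_tendsto M C)}"
  \<comment> \<open>Zorn's lemma for the reversed order, so that a maximal element is a minimal
    sequence of cosets.\<close>
  have "\<exists>C\<in>A. \<forall>B\<in>A. B \<le> C \<longrightarrow> B = C"
  proof (rule predicate_Zorn[where P = "\<lambda>C B. B \<le> C"])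
    show "partial_order_on A (relation_of (\<lambda>C B. B \<le> C) A)"
      by (rule partial_order_on_relation_ofI) auto
    fix K assume K: "K \<in> Chains (relation_of (\<lambda>C B. B \<le> C) A)"
    show "\<exists>B\<in>A. \<forall>C\<in>K. B \<le> C"
    proof (cases "K = {}")
      case True
      then show ?thesis using D by (auto simp: A_def)
    next
      case False
      have KA: "K \<subseteq> A" using K by (rule Chains_relation_of)
      then have "\<forall>C\<in>K. \<exists>M. cosets_tendsto M C"
        unfolding A_def by blast
      then obtain M where M: "\<And>C. C \<in> K \<Longrightarrow> cosets_tendsto (M C) C"
        using bchoice[of K "\<lambda>C M. cosets_tendsto M C"] by blast
      have "cosets_tendsto (\<Inter>C\<in>K. M C) (\<lambda>n. \<Inter>C\<in>K. C n)"
        using K by (intro cosets_tendsto_chain_Inter False M)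
          (auto simp: Chains_def relation_of_def)
      moreover have le: "(\<lambda>n. \<Inter>C\<in>K. C n) \<le> C" if "C \<in> K" for C
        using that by (auto simp: le_fun_def)
      moreover have "(\<lambda>n. \<Inter>C\<in>K. C n) \<le> D"
      proof -
        obtain C where "C \<in> K" using False by blast
        then show ?thesis using le[of C] KA by (auto simp: A_def intro: order_trans)
      qed
      ultimately show ?thesis
        unfolding A_def by blast
    qed
  qed
  then obtain C M where C: "C \<le> D" "cosets_tendsto M C" and min: "\<And>B. B \<in> A \<Longrightarrow> B \<le> C \<Longrightarrow> B = C"
    unfolding A_def by blast
  have M0: "m = 0" if m: "m \<in> M" for m
  proof (rule ccontr)
    assume "m \<noteq> 0"
    then obtain M' C' where C': "cosets_tendsto M' C'" "C' \<le> C" "m \<notin> M'"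
      using cosets_tendsto_refine[OF C(2) m] by blast
    then have "C' = C"
      using C(1) by (intro min) (auto simp: A_def)
    then have "M \<subseteq> M'"
      using cosets_tendsto_mono[OF C(2) C'(1)] by simp
    then show False using C'(3) m by blast
  qed
  then have M: "M = {0}"
    using C(2) by (auto simp: cosets_tendsto_def add_subgroup_def)
  then obtain y where y: "\<And>n. C n = {y n}"
    using C(2) unfolding cosets_tendsto_def by simp metis
  show thesis
  proof
    show "y n \<in> D n" for n using C(1) y[of n] by (auto simp: le_fun_def)
    show "y \<longlonglongrightarrow> 0"
    proof (rule topological_tendstoI)
      fix S :: "'a set" assume "open S" "0 \<in> S"
      then have "\<forall>\<^sub>F n in sequentially. C n \<subseteq> S"
        using C(2) M by (auto simp: cosets_tendsto_def)
      then show "\<forall>\<^sub>F n in sequentially. y n \<in> S" by (simp add: y)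
    qed
  qed
qed

section \<open>Complete sequences of neighbourhoods\<close>

text \<open>
  The common consequence of Cech completeness and local compactness on which the proof rests: every
  point has such a sequence of open neighbourhoods.
\<close>

definition complete_nhds :: "(nat \<Rightarrow> 'a::topological_space set) \<Rightarrow> bool" where
  "complete_nhds Q \<longleftrightarrow> (\<forall>F. F \<noteq> bot \<longrightarrow> (\<forall>n. \<forall>\<^sub>F x in F. x \<in> Q n) \<longrightarrow> (\<exists>p. inf (nhds p) F \<noteq> bot))"

text \<open>A filter concentrated on the intersection clusters, and does so inside it because it is
  closed. If no \<open>V n\<close> were contained in \<open>W\<close>, points \<open>z n\<close> of
  \<open>V n - W\<close> would cluster at a point of every \<open>closure (V n)\<close>, hence in
  \<open>W\<close>, although the complement of \<open>W\<close> is closed.\<close>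

lemma nhd_chain_complete:
  fixes V :: "nat \<Rightarrow> 'a::{topological_group_add, t2_space} set"
  assumes V: "nhd_chain V" and Q: "complete_nhds Q" "\<And>n. V n \<subseteq> Q n"
  shows "compact (\<Inter>n. V n)"
    and "open W \<Longrightarrow> (\<Inter>n. V n) \<subseteq> W \<Longrightarrow> \<exists>n. V n \<subseteq> W"
proof -
  let ?N = "\<Inter>n. V n"
  show "compact ?N"
    unfolding compact_filter
  proof (intro allI impI)
    fix F assume F: "F \<noteq> bot" "\<forall>\<^sub>F x in F. x \<in> ?N"
    then have "\<forall>n. \<forall>\<^sub>F x in F. x \<in> Q n"
      using Q(2) by (auto elim!: eventually_mono)
    then obtain p where "inf (nhds p) F \<noteq> bot"
      using Q(1) F(1) by (auto simp: complete_nhds_def)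
    then show "\<exists>p\<in>?N. inf (nhds p) F \<noteq> bot"
      using cluster_point_in_closed[OF _ closed_nhd_chain_Inter[OF V] F(2)] by blast
  qed
  assume W: "open W" "?N \<subseteq> W"
  show "\<exists>n. V n \<subseteq> W"
  proof (rule ccontr)
    assume "\<nexists>n. V n \<subseteq> W"
    then obtain z where z: "\<And>n. z n \<in> V n" "\<And>n. z n \<notin> W"
      using choice[of "\<lambda>n z. z \<in> V n \<and> z \<notin> W"] by blast
    define F where "F = filtermap z sequentially"
    have ev: "\<forall>\<^sub>F x in F. x \<in> V n" for n
      unfolding F_def eventually_filtermap
      using eventually_ge_at_top[of n]
      by eventually_elim (use z(1) nhd_chain_mono[OF V] in blast)
    have "\<forall>\<^sub>F x in F. x \<in> Q n" for n
      using ev[of n] by (rule eventually_mono) (use Q(2) in blast)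
    moreover have "F \<noteq> bot"
      by (simp add: F_def filtermap_bot_iff)
    ultimately obtain p where p: "inf (nhds p) F \<noteq> bot"
      using Q(1) by (auto simp: complete_nhds_def)
    have "p \<in> closure (V n)" for n
      using p ev[of n] closure_subset
      by (intro cluster_point_in_closed[OF p]) (auto elim!: eventually_mono)
    then have "p \<in> W"
      using W(2) nhd_chain_Inter_closure[OF V] by blast
    moreover have "p \<in> - W"
      using z(2) W(1) by (intro cluster_point_in_closed[OF p]) (auto simp: F_def eventually_filtermap)
    ultimately show False by simp
  qed
qed

section \<open>Construction of the convergent sequence\<close>

lemma complete_nhds_imp_sequence_to_zero:
  fixes U :: "'a::{topological_group_add, t2_space} set" and Q :: "nat \<Rightarrow> 'a set"
  assumes Q: "complete_nhds Q" "\<And>n. open (Q n)" "\<And>n. 0 \<in> Q n"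
    and U: "open U" "0 \<in> closure U"
  obtains y where "\<And>n. y n \<in> U" "y \<longlonglongrightarrow> 0"
proof -
  \<comment> \<open>The recursion carries pairs \<open>(V, x)\<close>; a point \<open>x\<close>
    exists at each stage because \<open>0\<close> lies in the closure of \<open>U\<close>.\<close>
  define P where "P = (\<lambda>n (V::'a set, x). open V \<and> 0 \<in> V \<and> (\<forall>x\<in>V. - x \<in> V) \<and> V \<subseteq> Q n \<and> x \<in> V \<inter> U)"
  define R where "R = (\<lambda>(n::nat) (V::'a set, x) (V'::'a set, x'::'a). (\<forall>a\<in>V'. \<forall>b\<in>V'. a + b \<in> V) \<and> (\<forall>a\<in>V'. x + a \<in> U))"
  have step: "\<exists>V' x'. P n (V', x') \<and> (\<forall>a\<in>V'. \<forall>b\<in>V'. a + b \<in> T)" if "open T" "0 \<in> T" for T n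
  proof -
    have "open (T \<inter> Q n)" "0 \<in> T \<inter> Q n" using that Q by auto
    from symmetric_open_nhd[OF this] obtain V' where V': "open V'" "0 \<in> V'"
      "\<And>x. x \<in> V' \<Longrightarrow> - x \<in> V'" "\<And>x y. x \<in> V' \<Longrightarrow> y \<in> V' \<Longrightarrow> x + y \<in> T \<inter> Q n"
      by blast
    moreover have "V' \<subseteq> Q n" using V'(4)[of _ 0] V'(2) by auto
    moreover obtain x' where "x' \<in> V' \<inter> U"
      using U(2) V'(1,2) open_Int_closure_eq_empty[of V' U] by blast
    ultimately show ?thesis unfolding P_def by blast
  qed
  have "\<exists>f. \<forall>n. P n (f n) \<and> R n (f n) (f (Suc n))"
  proof (rule dependent_nat_choice)
    show "\<exists>f. P 0 f" using step[of UNIV 0] by auto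
    fix f n assume f: "P n f"
    obtain V x where Vx: "f = (V, x)" by (cases f)
    \<comment> \<open>Applying \<open>step\<close> to this set secures both clauses of
      \<open>R\<close> at once: the halving of \<open>V\<close> and, by taking \<open>0\<close> as
      second summand, \<open>x + V' \<subseteq> U\<close>.\<close>
    have "open (V \<inter> {a. x + a \<in> U})" "0 \<in> V \<inter> {a. x + a \<in> U}"
      using f U(1) by (auto simp: Vx P_def open_translate_vimage)
    from step[OF this, of "Suc n"] obtain V' x' where V': "P (Suc n) (V', x')"
      "\<forall>a\<in>V'. \<forall>b\<in>V'. a + b \<in> V \<inter> {a. x + a \<in> U}" by blast
    then have "0 \<in> V'" by (simp add: P_def)
    then have "\<forall>a\<in>V'. x + a \<in> U" using V'(2) by force
    then show "\<exists>g. P (Suc n) g \<and> R n f g"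
      using V' by (intro exI[of _ "(V', x')"]) (simp add: R_def Vx)
  qed
  then obtain f where f: "\<And>n. P n (f n)" "\<And>n. R n (f n) (f (Suc n))" by blast
  define V where "V n = fst (f n)" for n
  define x where "x n = snd (f n)" for n
  have fn: "f n = (V n, x n)" for n by (simp add: V_def x_def)
  have V: "nhd_chain V" and VQ: "V n \<subseteq> Q n" and x: "x n \<in> V n"
    and xU: "a \<in> V (Suc n) \<Longrightarrow> x n + a \<in> U" for n a
    using f unfolding nhd_chain_def fn P_def R_def by auto
  let ?N = "\<Inter>n. V n"
  have "cosets_tendsto ?N (\<lambda>n. (+) (x n) ` ?N)"
    unfolding cosets_tendsto_def
  proof (intro conjI allI impI)
    show "compact ?N" by (rule nhd_chain_complete[OF V Q(1) VQ])
    show "add_subgroup ?N" by (rule add_subgroup_nhd_chain_Inter[OF V])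
    show "\<exists>y. (+) (x n) ` ?N = (+) y ` ?N" for n by blast
    fix W assume "open W \<and> ?N \<subseteq> W"
    then obtain k where k: "V k \<subseteq> W"
      using nhd_chain_complete(2)[OF V Q(1) VQ] by blast
    show "\<forall>\<^sub>F n in sequentially. (+) (x n) ` ?N \<subseteq> W"
      using eventually_ge_at_top[of "Suc k"]
    proof eventually_elim
      case (elim n)
      \<comment> \<open>One index is spent on adding an element of \<open>?N\<close> to
        \<open>x n\<close>.\<close>
      then have "x n \<in> V (Suc k)" using x[of n] nhd_chain_mono[OF V elim] by blast
      then have "(+) (x n) ` ?N \<subseteq> V k"
        using nhd_chain_add[OF V] by blast
      then show ?case using k by blast
    qed
  qed
  then obtain y where y: "\<And>n. y n \<in> (+) (x n) ` ?N" "y \<longlonglongrightarrow> 0"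
    using cosets_tendsto_selection by blast
  have "y n \<in> U" for n
  proof -
    obtain a where "y n = x n + a" "a \<in> ?N" using y(1)[of n] by blast
    \<comment> \<open>\<open>a\<close> lies in \<open>V (Suc n)\<close>, which was chosen after
      \<open>x n\<close> to keep \<open>x n + V (Suc n)\<close> inside \<open>U\<close>.\<close>
    then show ?thesis using xU[of a n] by simp
  qed
  then show thesis using y(2) by (rule that)
qed

lemma complete_nhds_imp_kappa_frechet_urysohn:
  fixes Q :: "nat \<Rightarrow> 'a::{topological_group_add, t2_space} set"
  assumes Q: "complete_nhds Q" "\<And>n. open (Q n)" "\<And>n. 0 \<in> Q n"
  shows "kappa_frechet_urysohn_space (euclidean :: 'a topology)"
  unfolding kappa_frechet_urysohn_space_def
proof (intro allI impI)
  fix U :: "'a set" and x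
  assume "openin euclidean U \<and> x \<in> euclidean closure_of U"
  then have U: "open U" "x \<in> closure U" by auto
  \<comment> \<open>The left translate \<open>- x + U\<close>, which moves \<open>x\<close> to
    \<open>0\<close>.\<close>
  let ?U = "{y. x + y \<in> U}"
  have "0 \<in> closure ?U"
    unfolding closure_iff_nhds_not_empty
  proof (intro allI impI)
    fix A S :: "'a set" assume S: "S \<subseteq> A" "open S" "0 \<in> S"
    have "open {y. - x + y \<in> S}" "x \<in> {y. - x + y \<in> S}"
      using S by (auto simp: open_translate_vimage)
    then obtain u where "u \<in> U" "- x + u \<in> S"
      using U(2) open_Int_closure_eq_empty[of "{y. - x + y \<in> S}" U] by blast
    then have "- x + u \<in> ?U \<inter> A" using S(1) by (auto simp: add.assoc[symmetric])
    then show "?U \<inter> A \<noteq> {}" by blast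
  qed
  then obtain y where y: "\<And>n. y n \<in> ?U" "y \<longlonglongrightarrow> 0"
    using complete_nhds_imp_sequence_to_zero[OF Q open_translate_vimage(1)[OF U(1)]] by blast
  have "(\<lambda>n. x + y n) \<longlonglongrightarrow> x + 0"
    by (intro tendsto_intros y)
  then show "\<exists>\<sigma>::nat \<Rightarrow> 'a. range \<sigma> \<subseteq> U \<and> limitin euclidean \<sigma> x sequentially"
    using y(1) by (intro exI[of _ "\<lambda>n. x + y n"]) auto
qed

section \<open>Locally compact and Cech-complete spaces\<close>

text \<open>A constant sequence suffices: a proper filter concentrated on a neighbourhood inside a
  compact set has a cluster point.\<close>

lemma locally_compact_complete_nhds:
  fixes a :: "'a::topological_space"
  assumes "locally_compact_space (euclidean :: 'a topology)"
  obtains Q where "complete_nhds Q" "\<And>n. open (Q n)" "\<And>n. a \<in> Q n"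
proof -
  obtain U K where U: "open U" "compact K" "a \<in> U" "U \<subseteq> K"
    using assms by (simp add: locally_compact_space_def) metis
  have "complete_nhds (\<lambda>_. U)"
    unfolding complete_nhds_def
  proof (intro allI impI)
    fix F assume "F \<noteq> bot" "\<forall>n::nat. \<forall>\<^sub>F x in F. x \<in> U"
    then have "\<forall>\<^sub>F x in F. x \<in> K" using U(4) by (auto elim!: eventually_mono)
    then show "\<exists>p. inf (nhds p) F \<noteq> bot"
      using U(2) \<open>F \<noteq> bot\<close> unfolding compact_filter by blast
  qed
  then show thesis using that U by blast
qed

text \<open>The point \<open>p\<close> is a cluster point of the image of \<open>F\<close> under
  \<open>e\<close>. Finitely many of the closures have a common point, since \<open>e x\<close> lies
  in all of them for \<open>F\<close>-eventually all \<open>x\<close> and \<open>F\<close> is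
  proper.\<close>

lemma compact_space_filter_cluster:
  assumes X: "compact_space X" and F: "F \<noteq> bot" "\<forall>\<^sub>F x in F. e x \<in> topspace X"
  obtains p where "p \<in> topspace X" "\<And>A. \<forall>\<^sub>F x in F. x \<in> A \<Longrightarrow> p \<in> X closure_of (e ` A)"
proof -
  define \<U> where "\<U> = {X closure_of (e ` A) | A. \<forall>\<^sub>F x in F. x \<in> A}"
  have "\<Inter>\<G> \<noteq> {}" if "finite \<G>" "\<G> \<subseteq> \<U>" for \<G>
  proof -
    have "\<forall>\<^sub>F x in F. e x \<in> C" if C: "C \<in> \<U>" for C
    proof -
      obtain A where A: "C = X closure_of (e ` A)" "\<forall>\<^sub>F x in F. x \<in> A"
        using C unfolding \<U>_def by blast
      from A(2) F(2) show ?thesis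
        by eventually_elim (auto simp: A(1) in_closure_of)
    qed
    then have "\<forall>\<^sub>F x in F. \<forall>C\<in>\<G>. e x \<in> C"
      using that by (auto simp: eventually_ball_finite_distrib)
    then show ?thesis
      using F(1) eventually_happens by blast
  qed
  moreover have "\<forall>C\<in>\<U>. closedin X C" by (auto simp: \<U>_def)
  ultimately have "\<Inter>\<U> \<noteq> {}"
    using X[unfolded compact_space_fip, rule_format, of \<U>] by simp
  then obtain p where p: "p \<in> \<Inter>\<U>" by blast
  show thesis
  proof
    show cl: "p \<in> X closure_of (e ` A)" if "\<forall>\<^sub>F x in F. x \<in> A" for A
      using p that by (auto simp: \<U>_def)
    show "p \<in> topspace X"
      using cl[of UNIV] by (simp add: in_closure_of)
  qed
qed

text \<open>Regularity of the compactification gives open \<open>T n\<close> around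
  \<open>e a\<close> with closures inside the G-delta layers \<open>G n\<close>. A filter
  concentrated on all their preimages clusters in the compactification at a point of every
  \<open>G n\<close>, hence at a point of the space.\<close>

lemma cech_complete_complete_nhds:
  fixes a :: "'a::topological_space"
  assumes "cech_complete_space (euclidean :: 'a topology)"
  obtains Q where "complete_nhds Q" "\<And>n. open (Q n)" "\<And>n. a \<in> Q n"
proof -
  define B where "B = stone_cech (euclidean :: 'a topology)"
  define e where "e = stone_cech_map (euclidean :: 'a topology)"
  have B: "compact_space B" "regular_space B"
    unfolding B_def
    by (simp_all add: compact_space_stone_cech Hausdorff_space_stone_cech compact_Hausdorff_imp_regular_space)
  have cont: "continuous_map euclidean B e"
    unfolding B_def e_def by (rule continuous_map_stone_cech_map)
  then have eB: "e x \<in> topspace B" for x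
    by (auto simp: continuous_map_def)
  have "embedding_map euclidean B e"
    using assms embedding_map_stone_cech_map unfolding B_def e_def cech_complete_space_def by blast
  then have hom: "homeomorphic_map euclidean (subtopology B (range e)) e"
    unfolding embedding_map_def by (simp only: topspace_euclidean)
  have inj: "inj e"
    using homeomorphic_imp_injective_map[OF hom] by (simp only: topspace_euclidean)
  have "gdelta_in B (range e)"
    using assms unfolding B_def e_def cech_complete_space_def by simp
  then obtain G where "(\<forall>n. openin B (G n)) \<and> (\<forall>n. G (Suc n) \<subseteq> G n) \<and> (\<Inter>n. G n) = range e"
    unfolding gdelta_in_descending ..
  then have G: "openin B (G n)" "(\<Inter>n. G n) = range e" for n
    by auto
  have "\<exists>T. openin B T \<and> e a \<in> T \<and> B closure_of T \<subseteq> G n" for n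
  proof -
    have "closedin B (topspace B - G n)" "e a \<in> topspace B - (topspace B - G n)"
      using G eB[of a] by auto
    then obtain T where "openin B T" "e a \<in> T" "disjnt (topspace B - G n) (B closure_of T)"
      using B(2) unfolding regular_space by blast
    then show ?thesis
      using closure_of_subset_topspace[of B T] by (fastforce simp: disjnt_iff)
  qed
  then obtain T where T: "\<And>n. openin B (T n)" "\<And>n. e a \<in> T n" "\<And>n. B closure_of T n \<subseteq> G n"
    by metis
  have "complete_nhds (\<lambda>n. e -` T n)"
    unfolding complete_nhds_def
  proof (intro allI impI)
    fix F assume F: "F \<noteq> bot" "\<forall>n. \<forall>\<^sub>F x in F. x \<in> e -` T n"
    obtain p where p: "p \<in> topspace B" "\<And>A. \<forall>\<^sub>F x in F. x \<in> A \<Longrightarrow> p \<in> B closure_of (e ` A)"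
      using compact_space_filter_cluster[OF B(1) F(1), of e] eB by auto
    have "p \<in> G n" for n
      using p(2)[of "e -` T n"] F(2) T(3)[of n] closure_of_mono[of "e ` (e -` T n)" "T n" B] by blast
    then obtain q where q: "p = e q" using G(2) by blast
    \<comment> \<open>Openness of \<open>e\<close> onto its range turns a neighbourhood
      \<open>S\<close> of \<open>q\<close> into the trace of an open \<open>S'\<close> around
      \<open>p\<close>, which must meet the image of \<open>{x. R x}\<close>; injectivity brings the
      common point back into \<open>S\<close>.\<close>
    have "\<not> (\<forall>\<^sub>F x in inf (nhds q) F. False)"
    proof
      assume "\<forall>\<^sub>F x in inf (nhds q) F. False"
      then obtain P R where PR: "\<forall>\<^sub>F x in nhds q. P x" "\<forall>\<^sub>F x in F. R x" "\<And>x. P x \<Longrightarrow> R x \<Longrightarrow> False"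
        unfolding eventually_inf by blast
      then obtain S where S: "open S" "q \<in> S" "\<And>x. x \<in> S \<Longrightarrow> P x"
        unfolding eventually_nhds by blast
      have "openin (subtopology B (range e)) (e ` S)"
        using homeomorphic_imp_open_map[OF hom] S(1) by (simp only: open_map_def open_openin)
      then obtain S' where S': "openin B S'" "e ` S = S' \<inter> range e"
        by (auto simp: openin_subtopology)
      have "p \<in> B closure_of (e ` {x. R x})" using PR(2) by (intro p(2)) simp
      moreover have "p \<in> S'" using S'(2) S(2) q by blast
      ultimately obtain x where x: "R x" "e x \<in> S'"
        using S'(1) by (auto simp: in_closure_of)
      then have "e x \<in> e ` S" using S'(2) by blast
      then have "x \<in> S" by (simp only: inj_image_mem_iff[OF inj])
      then show False using PR(3) S(3) x(1) by blast
    qed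
    then show "\<exists>p. inf (nhds p) F \<noteq> bot"
      unfolding trivial_limit_def by blast
  qed
  moreover have "open (e -` T n)" for n
    using openin_continuous_map_preimage[OF cont T(1)[of n]] by (simp add: vimage_def)
  moreover have "a \<in> e -` T n" for n using T(2) by simp
  ultimately show thesis by (rule that)
qed

theorem corollary6p2:
  shows "(cech_complete_space (euclidean :: 'a::{topological_group_add, t2_space} topology) \<longrightarrow>
            kappa_frechet_urysohn_space (euclidean :: 'a topology)) \<and>
         (locally_compact_space (euclidean :: 'a topology) \<longrightarrow>
            kappa_frechet_urysohn_space (euclidean :: 'a topology))"
  \<comment> \<open>Either hypothesis supplies the required neighbourhoods at the point
    \<open>0\<close>.\<close>
  by (meson cech_complete_complete_nhds locally_compact_complete_nhds
        complete_nhds_imp_kappa_frechet_urysohn)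

end
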